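(* Let $q>1$, $\mathcal{Q}=\{q^n : n\in\mathbb{N}_0\}$, $a\in\mathcal{Q}$, $r\in\mathbb{N}$, $\alpha_0,\ldots,\alpha_{r-1}\in\mathbb{R}$, and let $(t,u_1,\ldots,u_{r+1})\mapsto L(t,u_1,\ldots,u_{r+1})\in\mathbb{R}$ ($t\in\mathcal{Q}$, $u_j\in\mathbb{R}$) be such that $(u_1,\ldots,u_{r+1})\mapsto L(t,u_1,\ldots,u_{r+1})$ is $C^1(\mathbb{R}^{r+1},\mathbb{R})$ for every $t\in\mathcal{Q}$. Suppose that $x_*:[a,+\infty[\rightarrow\mathbb{R}$ is an optimal (i.e. weakly maximal) path for the problem $$\int_a^{+\infty} L\langle x\rangle(t)\,d_qt\longrightarrow\max,\qquad x(a)=\alpha_0,\ D_q[x](a)=\alpha_1,\ \ldots,\ D_q^{r-1}[x](a)=\alpha_{r-1}.$$ For $\eta:[a,+\infty[\rightarrow\mathbb{R}$ with $\eta(a)=0$, $D_q[\eta](a)=0$, ..., $D_q^{r-1}[\eta](a)=0$, define (for $T,T'\in\mathcal{Q}$ with $T,T'>a$) $$A(\varepsilon,T'):=\int_a^{T'}\frac{L\langle x_*+\varepsilon\eta\rangle(t)-L\langle x_*\rangle(t)}{\varepsilon}\,d_qt\quad(\varepsilon\neq0),$$ $$V(\varepsilon,T):=\inf_{T'\ge T}\int_a^{T'}\bigl(L\langle x_*+\varepsilon\eta\rangle(t)-L\langle x_*\rangle(t)\bigr)\,d_qt,\qquad V(\varepsilon):=\lim_{T\to+\infty}V(\varepsilon,T).$$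 Suppose that, for every such $\eta$: 1. $\lim_{\varepsilon\to0}\frac{V(\varepsilon,T)}{\varepsilon}$ exists for all $T$; 2. $\lim_{T\to+\infty}\frac{V(\varepsilon,T)}{\varepsilon}$ exists uniformly for $\varepsilon$ (where $\varepsilon\in\mathbb{R}\setminus\{0\}$); 3. for every $T\in\mathcal{Q}$ with $T>a$ there is a sequence $(T'_n)_{n\in\mathbb{N}}$ in $\mathcal{Q}$ with $T'_n\ge T$ such that $\lim_{n\to+\infty}A(\varepsilon,T'_n)=\inf_{T'\ge T}A(\varepsilon,T')$ uniformly for $\varepsilon\in\mathbb{R}\setminus\{0\}$. Then $x=x_*$ satisfies the Euler--Lagrange equation $$\sum_{i=0}^{r}(-1)^i\left(\frac1q\right)^{\frac{i(i-1)}{2}}D_q^i\left[\partial_{i+2}L\langle x\rangle\right](t)=0\quad\text{for all }t\in[a,+\infty[,$$ and the $r$ transversality conditions, for $k=1,2,\ldots,r$, $$\lim_{T\to+\infty}\inf_{T'\ge T}\left\{\left(\partial_{r+2-(k-1)}L\langle x\rangle(T')+\sum_{i=1}^{k-1}(-1)^iD_q^i\left[\partial_{r+2-(k-1)+i}L\langle x\rangle\right](T')\cdot\Psi_i\right)\cdot D_q^{r-k}[x\circ\sigma^{k-1}](T')\right\}=0,$$ where $\Psi_i=\prod_{j=1}^{i}\left(\frac1q\right)^{r-(k-1)+(j-1)}$.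
   Context: Fix a real $q>1$ and $\mathcal{Q}=\{q^n:n\in\mathbb{N}_0\}$; $\mathbb{N}=\{1,2,\ldots\}$. All intervals are $q$-intervals: for $a,b\in\mathcal{Q}$, $[a,b]=\{t\in\mathcal{Q}:a\le t\le b\}$ and $[a,+\infty[=\{t\in\mathcal{Q}:t\ge a\}$. The map $\sigma$ is $\sigma(t)=qt$, with $\sigma^0=\mathrm{id}$, $\sigma^k=\sigma\circ\sigma^{k-1}$, so $\sigma^k(t)=q^kt$. The Jackson $q$-difference operator is $D_q[f](t)=\frac{f(qt)-f(t)}{(q-1)t}$, with $D_q^0[f]=f$ and $D_q^r[f]=D_q[D_q^{r-1}[f]]$. For $b=aq^n$ ($n\in\mathbb{N}_0$), $\int_a^bf(t)\,d_qt=a(q-1)\sum_{k=0}^{n-1}q^kf(aq^k)$, and $\int_a^{+\infty}f(t)\,d_qt=\lim_{b\to+\infty}\int_a^bf(t)\,d_qt$ when it exists in $\overline{\mathbb{R}}=\mathbb{R}\cup\{\pm\infty\}$. In expressions $\lim_{T\to+\infty}\inf_{T'\ge T}$, $T$ and $T'$ range over elements of $\mathcal{Q}$ with $T'\ge T>a$. Empty sums are $0$. Notation: $\langle x\rangle(t)=\left(t,(x\circ\sigma^r)(t),D_q[x\circ\sigma^{r-1}](t),\ldots,D_q^{r-1}[x\circ\sigma](t),D_q^r[x](t)\right)$, so that $L\langle x\rangle(t)=L(\langle x\rangle(t))$; $\partial_iL$ denotes the partial derivative of $L$ with respect to its $i$th argument, where $t$ is the first argument (so $\partial_{i+2}L$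 is the partial derivative with respect to $u_{i+1}$), and $\partial_iL\langle x\rangle$ is the function $t\mapsto\partial_iL(\langle x\rangle(t))$. A function $x:[a,+\infty[\rightarrow\mathbb{R}$ is an admissible path if $x(a)=\alpha_0$, $D_q[x](a)=\alpha_1$, ..., $D_q^{r-1}[x](a)=\alpha_{r-1}$. A path $x_*$ is weakly maximal if it is admissible and, for all admissible $x$, $\lim_{T\to+\infty}\inf_{T'\ge T}\int_a^{T'}\left[L\langle x\rangle(t)-L\langle x_*\rangle(t)\right]d_qt\le0$. *)

theory Defs
  imports "HOL-Analysis.Analysis"
begin

text \<open>Functions on the q-interval \<open>[a,\<infinity>[\<close> are represented by total functions on the reals;
  only their values on that q-interval enter the statements.\<close>

definition qset :: "real \<Rightarrow> real set" where
  "qset q = range (\<lambda>n::nat. q ^ n)"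

definition sigma :: "real \<Rightarrow> real \<Rightarrow> real" where
  "sigma q t = q * t"

definition qdiff :: "real \<Rightarrow> (real \<Rightarrow> real) \<Rightarrow> real \<Rightarrow> real" where
  "qdiff q f t = (f (q * t) - f t) / ((q - 1) * t)"

text \<open>Meant for \<open>b = a q\<^sup>n\<close> with \<open>q > 1\<close> and \<open>a \<noteq> 0\<close>, where the exponent is unique.\<close>

definition qint :: "real \<Rightarrow> real \<Rightarrow> real \<Rightarrow> (real \<Rightarrow> real) \<Rightarrow> real" where
  "qint q a b f = a * (q - 1) * (\<Sum>k < (THE n::nat. b = a * q ^ n). q ^ k * f (a * q ^ k))"

definition qtop :: "real \<Rightarrow> real \<Rightarrow> real filter" where
  "qtop q a = inf at_top (principal {T \<in> qset q. a < T})"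

definition inf_from :: "real \<Rightarrow> (real \<Rightarrow> real) \<Rightarrow> real \<Rightarrow> ereal" where
  "inf_from q f T = (INF T' \<in> {T' \<in> qset q. T \<le> T'}. ereal (f T'))"

text \<open>Points of \<open>\<real>\<^sup>r\<^sup>+\<^sup>1\<close> are vectors over a finite index type \<open>'n\<close>. An enumeration
  \<open>ix\<close>, a bijection from \<open>{1..r+1}\<close> onto \<open>'n\<close>, fixes the order of the coordinates: \<open>u\<^sub>j\<close> is
  \<open>u $ ix j\<close>. The vector \<open>jet\<close> omits the leading component \<open>t\<close> of the tuple, since
  \<open>t\<close> is a separate argument of \<open>L\<close>.\<close>

definition jet :: "real \<Rightarrow> nat \<Rightarrow> (nat \<Rightarrow> 'n::finite) \<Rightarrow> (real \<Rightarrow> real) \<Rightarrow> real \<Rightarrow> real ^ 'n" where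
  "jet q r ix x t = (\<chi> c. let j = inv_into {1..r+1} ix c in
     (qdiff q ^^ (j - 1)) (x \<circ> (sigma q ^^ (r - (j - 1)))) t)"

lemma jet_nth:
  assumes "bij_betw ix {1..r+1} UNIV" "j \<in> {1..r+1}"
  shows "jet q r ix x t $ ix j = (qdiff q ^^ (j - 1)) (x \<circ> (sigma q ^^ (r - (j - 1)))) t"
  using assms by (simp add: jet_def bij_betw_def Let_def del: Nat.One_nat_def)

definition lagr :: "real \<Rightarrow> nat \<Rightarrow> (nat \<Rightarrow> 'n::finite) \<Rightarrow> (real \<Rightarrow> real ^ 'n \<Rightarrow> real)
    \<Rightarrow> (real \<Rightarrow> real) \<Rightarrow> real \<Rightarrow> real" where
  "lagr q r ix L x t = L t (jet q r ix x t)"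

text \<open>The argument \<open>t\<close> of \<open>L\<close> counts as the first one, so the \<open>i\<close>-th partial derivative
  (\<open>i \<ge> 2\<close>) is the one with respect to \<open>u\<^sub>i\<^sub>-\<^sub>1\<close>.\<close>

definition pderivL :: "(nat \<Rightarrow> 'n::finite) \<Rightarrow> nat \<Rightarrow> (real \<Rightarrow> real ^ 'n \<Rightarrow> real)
    \<Rightarrow> real \<Rightarrow> real ^ 'n \<Rightarrow> real" where
  "pderivL ix i L t u =
     deriv (\<lambda>s. L t (\<chi> c. if c = ix (i - 1) then s else u $ c)) (u $ ix (i - 1))"

definition C1 :: "('a::real_normed_vector \<Rightarrow> 'b::real_normed_vector) \<Rightarrow> bool" where
  "C1 f \<longleftrightarrow> (\<exists>f' :: 'a \<Rightarrow> 'a \<Rightarrow>\<^sub>L 'b.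
     (\<forall>u. (f has_derivative blinfun_apply (f' u)) (at u)) \<and> continuous_on UNIV f')"

definition admissible :: "real \<Rightarrow> real \<Rightarrow> nat \<Rightarrow> (nat \<Rightarrow> real) \<Rightarrow> (real \<Rightarrow> real) \<Rightarrow> bool" where
  "admissible q a r \<alpha> x \<longleftrightarrow> (\<forall>i<r. (qdiff q ^^ i) x a = \<alpha> i)"

text \<open>The limit always exists in the extended reals, because \<open>inf_from q f\<close> is monotone.\<close>

lemma inf_from_tendsto_ex: "\<exists>l. (inf_from q f \<longlongrightarrow> l) (qtop q a)"
proof -
  let ?S = "{T \<in> qset q. a < T}"
  have mono: "inf_from q f S \<le> inf_from q f T" if "S \<le> T" for S T
    unfolding inf_from_def by (rule INF_superset_mono) (use that in auto)
  have "(inf_from q f \<longlongrightarrow> (SUP T\<in>?S. inf_from q f T)) (qtop q a)"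
  proof (rule order_tendstoI)
    fix y assume "y < (SUP T\<in>?S. inf_from q f T)"
    then obtain T0 where "y < inf_from q f T0"
      by (auto simp: less_SUP_iff)
    then have "\<forall>T\<ge>T0. y < inf_from q f T"
      using mono less_le_trans by blast
    then have "\<forall>\<^sub>F T in at_top. y < inf_from q f T"
      by (auto simp: eventually_at_top_linorder)
    then show "\<forall>\<^sub>F T in qtop q a. y < inf_from q f T"
      unfolding qtop_def by (simp add: eventually_inf_principal eventually_mono)
  next
    fix y assume y: "(SUP T\<in>?S. inf_from q f T) < y"
    have "inf_from q f T < y" if "T \<in> ?S" for T
      using SUP_upper[OF that, of "inf_from q f"] y by (rule le_less_trans)
    then show "\<forall>\<^sub>F T in qtop q a. inf_from q f T < y"
      unfolding qtop_def by (simp add: eventually_inf_principal)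
  qed
  then show ?thesis ..
qed

definition weakly_maximal :: "real \<Rightarrow> real \<Rightarrow> nat \<Rightarrow> (nat \<Rightarrow> 'n::finite) \<Rightarrow> (nat \<Rightarrow> real)
    \<Rightarrow> (real \<Rightarrow> real ^ 'n \<Rightarrow> real) \<Rightarrow> (real \<Rightarrow> real) \<Rightarrow> bool" where
  "weakly_maximal q a r ix \<alpha> L xs \<longleftrightarrow> admissible q a r \<alpha> xs \<and>
     (\<forall>x. admissible q a r \<alpha> x \<longrightarrow>
        (\<exists>l\<le>0. (inf_from q (\<lambda>T'. qint q a T' (\<lambda>t. lagr q r ix L x t - lagr q r ix L xs t))
                  \<longlongrightarrow> l) (qtop q a)))"

definition A :: "real \<Rightarrow> real \<Rightarrow> nat \<Rightarrow> (nat \<Rightarrow> 'n::finite) \<Rightarrow> (real \<Rightarrow> real ^ 'n \<Rightarrow> real)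
    \<Rightarrow> (real \<Rightarrow> real) \<Rightarrow> (real \<Rightarrow> real) \<Rightarrow> real \<Rightarrow> real \<Rightarrow> real" where
  "A q a r ix L xs \<eta> \<epsilon> T' = qint q a T'
     (\<lambda>t. (lagr q r ix L (\<lambda>s. xs s + \<epsilon> * \<eta> s) t - lagr q r ix L xs t) / \<epsilon>)"

definition V :: "real \<Rightarrow> real \<Rightarrow> nat \<Rightarrow> (nat \<Rightarrow> 'n::finite) \<Rightarrow> (real \<Rightarrow> real ^ 'n \<Rightarrow> real)
    \<Rightarrow> (real \<Rightarrow> real) \<Rightarrow> (real \<Rightarrow> real) \<Rightarrow> real \<Rightarrow> real \<Rightarrow> ereal" where
  "V q a r ix L xs \<eta> \<epsilon> T = inf_from q (\<lambda>T'. qint q a T'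
     (\<lambda>t. lagr q r ix L (\<lambda>s. xs s + \<epsilon> * \<eta> s) t - lagr q r ix L xs t)) T"

text \<open>Uniform convergence of families that may take infinite values. As the absolute value of
  \<open>\<infinity> - \<infinity>\<close> is \<open>\<infinity>\<close> in \<open>ereal\<close>, this forces the values to be eventually finite and the limit
  to be finite.\<close>

definition ereal_uniform_limit ::
    "'x set \<Rightarrow> ('i \<Rightarrow> 'x \<Rightarrow> ereal) \<Rightarrow> ('x \<Rightarrow> ereal) \<Rightarrow> 'i filter \<Rightarrow> bool" where
  "ereal_uniform_limit S f l F \<longleftrightarrow>
     (\<forall>e>0. \<forall>\<^sub>F n in F. \<forall>x\<in>S. \<bar>f n x - l x\<bar> < ereal e)"

lemma ereal_uniform_limit_ereal:
  "ereal_uniform_limit S (\<lambda>n x. ereal (f n x)) (\<lambda>x. ereal (l x)) F \<longleftrightarrow> uniform_limit S f l F"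
  by (simp add: ereal_uniform_limit_def uniform_limit_iff dist_real_def)

definition Psi :: "real \<Rightarrow> nat \<Rightarrow> nat \<Rightarrow> nat \<Rightarrow> real" where
  "Psi q r k i = (\<Prod>j=1..i. (1 / q) ^ (r - (k - 1) + (j - 1)))"

end

theory Submission
  imports Defs
begin

text \<open>Why the theorem holds. Perturb the optimal path \<open>x\<close> by \<open>\<epsilon> \<eta>\<close>, where \<open>\<eta>\<close> satisfies the
  homogeneous initial conditions. Optimality gives \<open>V(\<epsilon>, T) \<le> 0\<close> for both signs of \<open>\<epsilon>\<close>, so a
  two-sided limit of \<open>V(\<epsilon>, T) / \<epsilon>\<close> must be zero. Comparing with the difference quotients of the
  integrals up to \<open>T' \<ge> T\<close> from both sides of \<open>\<epsilon> = 0\<close>, one finds that the integrated first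
  variation vanishes exactly, for every end point \<open>T'\<close> and every such \<open>\<eta>\<close>
  (\<open>integrated_first_variation_zero\<close>).

  Summation by parts (\<open>first_variation_eq\<close>) splits the first variation into the Euler--Lagrange
  expression times a shifted \<open>\<eta>\<close> and the q-difference of a boundary term. The boundary term is
  linear in the differences of \<open>\<eta>\<close>, and its coefficients, the momenta, are the brackets in the
  transversality conditions (\<open>momentum_closed_form\<close>).

  Since \<open>\<eta>\<close> is arbitrary beyond the first \<open>r\<close> points, it may be taken to be the indicator of one
  point. This yields the Euler--Lagrange equation at every point
  (\<open>euler_lagrange_of_first_variation\<close>), and then, the boundary term being triangular, that every
  momentum is zero from the point \<open>a q\<^sup>r\<close> on (\<open>momentum_vanishes_of_first_variation\<close>). The
  expressions in the transversality conditions are products of a momentum with a difference of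
  \<open>x\<close>; they are eventually zero, although \<open>x\<close> need not satisfy homogeneous initial conditions,
  and so are their infima over the tails.\<close>

section \<open>Iterated q-differences\<close>

lemma sigma_funpow: "(sigma q ^^ k) t = q ^ k * t"
  by (induction k) (simp_all add: sigma_def)

lemma qdiff_funpow_Suc:
  "(qdiff q ^^ Suc i) f t = ((qdiff q ^^ i) f (q * t) - (qdiff q ^^ i) f t) / ((q - 1) * t)"
  by (simp add: qdiff_def[abs_def])

lemma qdiff_funpow_cong:
  assumes "\<And>j. j \<le> i \<Longrightarrow> f (q ^ j * t) = g (q ^ j * t)"
  shows "(qdiff q ^^ i) f t = (qdiff q ^^ i) g t"
  using assms
proof (induction i arbitrary: t)
  case 0
  from 0[of 0] show ?case by simp
next
  case (Suc i)
  have "(qdiff q ^^ i) f t = (qdiff q ^^ i) g t"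
    by (rule Suc.IH) (use Suc.prems in auto)
  moreover have "(qdiff q ^^ i) f (q * t) = (qdiff q ^^ i) g (q * t)"
    by (rule Suc.IH) (use Suc.prems[of "Suc _"] in \<open>auto simp: mult.assoc mult.left_commute\<close>)
  ultimately show ?case by (simp only: qdiff_funpow_Suc)
qed

lemma qdiff_funpow_zero: "(qdiff q ^^ i) (\<lambda>_. 0) t = 0"
  by (induction i arbitrary: t) (simp_all add: qdiff_funpow_Suc del: funpow.simps(2))

lemma qdiff_funpow_eq_0:
  assumes "\<And>j. j \<le> i \<Longrightarrow> f (q ^ j * t) = 0"
  shows "(qdiff q ^^ i) f t = 0"
  using qdiff_funpow_cong[of i f q t "\<lambda>_. 0"] assms by (simp add: qdiff_funpow_zero)

text \<open>The value at \<open>t\<close> itself enters an iterated q-difference at \<open>t\<close> with a nonzero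
  coefficient. This is what makes the boundary term below solvable for its coefficients.\<close>

lemma qdiff_funpow_leading:
  assumes "\<And>j. 1 \<le> j \<Longrightarrow> j \<le> i \<Longrightarrow> f (q ^ j * t) = 0"
  shows "(qdiff q ^^ i) f t = (- 1 / ((q - 1) * t)) ^ i * f t"
  using assms
proof (induction i)
  case (Suc i)
  have "(qdiff q ^^ i) f (q * t) = 0"
    by (rule qdiff_funpow_eq_0)
      (use Suc.prems[of "Suc _"] in \<open>auto simp: mult.assoc mult.left_commute\<close>)
  with Suc show ?case by (simp add: qdiff_funpow_Suc del: funpow.simps(2))
qed simp

lemma qdiff_funpow_add_mult:
  "(qdiff q ^^ i) (\<lambda>s. f s + c * g s) t = (qdiff q ^^ i) f t + c * (qdiff q ^^ i) g t"
proof (induction i arbitrary: t)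
  case (Suc i)
  then show ?case
    by (simp only: qdiff_funpow_Suc) (simp add: diff_divide_distrib add_divide_distrib algebra_simps)
qed simp

text \<open>Every q-difference divides by \<open>(q - 1) t\<close>, so moving it past the dilation by \<open>q\<close>
  costs one factor \<open>q\<close>; these factors are the source of the powers of \<open>1 / q\<close> in the
  Euler--Lagrange equation.\<close>

lemma qdiff_funpow_dilate:
  assumes "q \<noteq> 0"
  shows "(qdiff q ^^ m) f (q * t) = (1 / q) ^ m * (qdiff q ^^ m) (f \<circ> sigma q) t"
proof (induction m arbitrary: t)
  case 0
  show ?case by (simp add: sigma_def)
next
  case (Suc m)
  show ?case using assms
    by (simp only: qdiff_funpow_Suc Suc)
      (simp add: comp_def right_diff_distrib[symmetric] mult.left_commute)
qed

lemma qdiff_mult: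
  "qdiff q (\<lambda>s. f s * g s) t = f t * qdiff q g t + qdiff q f t * g (q * t)"
  by (simp add: qdiff_def diff_divide_distrib algebra_simps)

lemma qdiff_add: "qdiff q (\<lambda>s. f s + g s) t = qdiff q f t + qdiff q g t"
  by (simp add: qdiff_def diff_divide_distrib add_divide_distrib)

section \<open>Summation by parts\<close>

text \<open>When the summand \<open>P\<^sub>j D\<^sup>j[\<eta> \<circ> \<sigma>\<^sup>r\<^sup>-\<^sup>j]\<close> is summed by parts, one q-difference at a time and
  starting from \<open>j = r\<close>, everything that multiplies a given difference of \<open>\<eta>\<close> can be collected
  before the next step is taken. This Horner scheme produces the discrete counterparts of the
  Ostrogradsky momenta: \<open>momentum k\<close> is the bracket in the \<open>k\<close>-th transversality condition, and
  \<open>momentum (r + 1)\<close> is the Euler--Lagrange expression.\<close>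

primrec momentum :: "real \<Rightarrow> nat \<Rightarrow> (nat \<Rightarrow> real \<Rightarrow> real) \<Rightarrow> nat \<Rightarrow> real \<Rightarrow> real" where
  "momentum q r P 0 = (\<lambda>t. 0)"
| "momentum q r P (Suc k) =
     (\<lambda>t. P (r - k) t - (1 / q) ^ (r - k) * qdiff q (momentum q r P k) t)"

lemma Psi_Suc:
  assumes "1 \<le> k" "k \<le> r"
  shows "Psi q r (Suc k) (Suc i) = (1 / q) ^ (r - k) * Psi q r k i"
proof -
  have Psi: "Psi q r k i = (\<Prod>j<i. (1 / q) ^ (r - (k - 1) + j))" for k i
    unfolding Psi_def One_nat_def by (subst prod.atLeast1_atMost_eq) simp
  have "r - (k - 1) = Suc (r - k)" using assms by simp
  then show ?thesis
    unfolding Psi by (subst prod.lessThan_Suc_shift) simp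
qed

lemma Psi_last: "Psi q r (Suc r) i = (1 / q) ^ (i * (i - 1) div 2)"
proof (induction i)
  case (Suc i)
  have "Suc i * (Suc i - 1) div 2 = i * (i - 1) div 2 + i"
    by (cases i) (auto simp: algebra_simps)
  with Suc show ?case by (simp add: Psi_def power_add del: mult_Suc)
qed (simp add: Psi_def)

lemma qdiff_sum_scaled:
  "qdiff q (\<lambda>t. \<Sum>i<n. c i * f i t) t = (\<Sum>i<(n::nat). c i * qdiff q (f i) t)"
proof (induction n)
  case (Suc n)
  then show ?case by (simp add: qdiff_add) (simp add: qdiff_def algebra_simps diff_divide_distrib)
qed (simp add: qdiff_def)

text \<open>Unrolling the recursion. The case \<open>k = r + 1\<close> belongs to the claim because it is the one
  that gives the Euler--Lagrange expression, where \<open>Psi\<close> turns into the powers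
  \<open>(1 / q)\<close> to the \<open>i (i - 1) / 2\<close> of \<open>Psi_last\<close>.\<close>

lemma momentum_closed_form:
  assumes "k \<le> Suc r"
  shows "momentum q r P k t =
    (\<Sum>i<k. ((-1) ^ i * Psi q r k i) * (qdiff q ^^ i) (P (Suc r - k + i)) t)"
  using assms
proof (induction k arbitrary: t)
  case (Suc k)
  have IH: "momentum q r P k =
      (\<lambda>t. \<Sum>i<k. ((-1) ^ i * Psi q r k i) * (qdiff q ^^ i) (P (Suc r - k + i)) t)"
    using Suc by auto
  have "(\<Sum>i<k. ((-1) ^ Suc i * Psi q r (Suc k) (Suc i)) *
          (qdiff q ^^ Suc i) (P (r - k + Suc i)) t)
      = - ((1 / q) ^ (r - k) * (\<Sum>i<k. ((-1) ^ i * Psi q r k i) *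
          qdiff q ((qdiff q ^^ i) (P (Suc r - k + i))) t))"
    unfolding sum_distrib_left sum_negf[symmetric]
  proof (rule sum.cong)
    fix i assume "i \<in> {..<k}"
    then have "1 \<le> k" "k \<le> r" "Suc r - k + i = r - k + Suc i" using Suc.prems by auto
    then show "((-1) ^ Suc i * Psi q r (Suc k) (Suc i)) *
          (qdiff q ^^ Suc i) (P (r - k + Suc i)) t
        = - ((1 / q) ^ (r - k) * (((-1) ^ i * Psi q r k i) *
          qdiff q ((qdiff q ^^ i) (P (Suc r - k + i))) t))"
      by (simp add: Psi_Suc)
  qed simp
  moreover have "Psi q r (Suc k) 0 = 1" by (simp add: Psi_def)
  ultimately show ?case
    by (simp add: IH qdiff_sum_scaled sum.lessThan_Suc_shift del: sum.lessThan_Suc)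
qed simp

definition boundary ::
    "real \<Rightarrow> nat \<Rightarrow> (nat \<Rightarrow> real \<Rightarrow> real) \<Rightarrow> (real \<Rightarrow> real) \<Rightarrow> nat \<Rightarrow> real \<Rightarrow> real" where
  "boundary q r P \<eta> n t = (\<Sum>k<n. momentum q r P (Suc k) t *
     (qdiff q ^^ (r - Suc k)) (\<eta> \<circ> (sigma q ^^ k)) t)"

definition first_variation ::
    "real \<Rightarrow> nat \<Rightarrow> (nat \<Rightarrow> real \<Rightarrow> real) \<Rightarrow> (real \<Rightarrow> real) \<Rightarrow> real \<Rightarrow> real" where
  "first_variation q r P \<eta> t = (\<Sum>j\<le>r. P j t * (qdiff q ^^ j) (\<eta> \<circ> (sigma q ^^ (r - j))) t)"

text \<open>The product rule turns the \<open>k\<close>-th boundary term into the part of the first variation that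
  carries \<open>r - k\<close> differences, up to what is passed on to the next momentum; hence all momenta
  but the last one cancel.\<close>

lemma qdiff_boundary_partial:
  assumes "q \<noteq> 0" "n \<le> r"
  shows "qdiff q (boundary q r P \<eta> n) t =
    (\<Sum>k\<le>n. P (r - k) t * (qdiff q ^^ (r - k)) (\<eta> \<circ> (sigma q ^^ k)) t)
    - momentum q r P (Suc n) t * (qdiff q ^^ (r - n)) (\<eta> \<circ> (sigma q ^^ n)) t"
  using assms(2)
proof (induction n)
  case 0
  show ?case by (simp add: boundary_def qdiff_def)
next
  case (Suc n)
  define G where "G = (qdiff q ^^ (r - Suc n)) (\<eta> \<circ> (sigma q ^^ n))"
  have "Suc (r - Suc n) = r - n" using Suc.prems by simp
  then have dG: "qdiff q G t = (qdiff q ^^ (r - n)) (\<eta> \<circ> (sigma q ^^ n)) t"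
    unfolding G_def by (metis comp_apply funpow.simps(2))
  have comp: "(\<eta> \<circ> (sigma q ^^ n)) \<circ> sigma q = \<eta> \<circ> (sigma q ^^ Suc n)"
    by (simp only: funpow_Suc_right comp_assoc)
  have sG: "G (q * t) =
      (1 / q) ^ (r - Suc n) * (qdiff q ^^ (r - Suc n)) (\<eta> \<circ> (sigma q ^^ Suc n)) t"
    unfolding G_def qdiff_funpow_dilate[OF assms(1)] comp ..
  have "boundary q r P \<eta> (Suc n) =
      (\<lambda>s. boundary q r P \<eta> n s + momentum q r P (Suc n) s * G s)"
    by (simp add: boundary_def G_def fun_eq_iff)
  then have "qdiff q (boundary q r P \<eta> (Suc n)) t = qdiff q (boundary q r P \<eta> n) t
      + (momentum q r P (Suc n) t * qdiff q G t + qdiff q (momentum q r P (Suc n)) t * G (q * t))"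
    by (simp only: qdiff_add qdiff_mult)
  also have "\<dots> = (\<Sum>k\<le>n. P (r - k) t * (qdiff q ^^ (r - k)) (\<eta> \<circ> (sigma q ^^ k)) t)
      + qdiff q (momentum q r P (Suc n)) t * G (q * t)"
    using Suc by (simp only: dG)
  also have "qdiff q (momentum q r P (Suc n)) t * G (q * t) =
      (P (r - Suc n) t - momentum q r P (Suc (Suc n)) t) *
      (qdiff q ^^ (r - Suc n)) (\<eta> \<circ> (sigma q ^^ Suc n)) t"
    unfolding sG by (subst momentum.simps(2)[of q r P "Suc n"]) (simp only: algebra_simps)
  finally show ?case
    by (simp only: sum.atMost_Suc left_diff_distrib add_diff_eq)
qed

lemma first_variation_eq:
  assumes "q \<noteq> 0"
  shows "first_variation q r P \<eta> t =
    momentum q r P (Suc r) t * \<eta> (q ^ r * t) + qdiff q (boundary q r P \<eta> r) t"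
proof -
  have "first_variation q r P \<eta> t =
      (\<Sum>k\<le>r. P (r - k) t * (qdiff q ^^ (r - k)) (\<eta> \<circ> (sigma q ^^ k)) t)"
    unfolding first_variation_def
    by (rule sum.reindex_bij_witness[of _ "\<lambda>k. r - k" "\<lambda>k. r - k"]) auto
  then show ?thesis
    by (simp only: qdiff_boundary_partial[OF assms order_refl]) (simp add: sigma_funpow)
qed

lemma boundary_eq_0:
  assumes "\<And>j. j < r \<Longrightarrow> \<eta> (q ^ j * t) = 0"
  shows "boundary q r P \<eta> r t = 0"
  unfolding boundary_def
proof (rule sum.neutral, safe)
  fix k assume "k < r"
  have "(qdiff q ^^ (r - Suc k)) (\<eta> \<circ> (sigma q ^^ k)) t = 0"
  proof (rule qdiff_funpow_eq_0)
    fix j assume "j \<le> r - Suc k"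
    then have "k + j < r" using \<open>k < r\<close> by simp
    from assms[OF this] show "(\<eta> \<circ> (sigma q ^^ k)) (q ^ j * t) = 0"
      by (simp add: sigma_funpow power_add mult.assoc)
  qed
  then show "momentum q r P (Suc k) t * (qdiff q ^^ (r - Suc k)) (\<eta> \<circ> (sigma q ^^ k)) t = 0"
    by simp
qed

section \<open>The q-interval as a sequence of points\<close>

lemma qset_pos: "1 < q \<Longrightarrow> t \<in> qset q \<Longrightarrow> 0 < t"
  by (auto simp: qset_def)

lemma qpoint_in_qset: "a \<in> qset q \<Longrightarrow> a * q ^ n \<in> qset q"
  by (auto simp: qset_def simp flip: power_add)

lemma qset_ge_obtain:
  assumes "1 < q" "a \<in> qset q" "t \<in> qset q" "a \<le> t"
  obtains n where "t = a * q ^ n"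
proof -
  obtain k m where km: "a = q ^ k" "t = q ^ m" using assms by (auto simp: qset_def)
  with assms have "k \<le> m" by (simp add: power_increasing_iff)
  then have "t = a * q ^ (m - k)" by (simp add: km flip: power_add)
  then show thesis by (rule that)
qed

lemma qint_qpoint:
  assumes "1 < q" "0 < a"
  shows "qint q a (a * q ^ n) f = a * (q - 1) * (\<Sum>k<n. q ^ k * f (a * q ^ k))"
  unfolding qint_def using assms by simp

lemma qint_divide: "qint q a b (\<lambda>t. f t / c) = qint q a b f / c"
  by (simp add: qint_def flip: sum_divide_distrib)

text \<open>The q-integral of a q-difference telescopes, which leaves the values of the boundary term
  at both ends.\<close>

lemma qint_first_variation:
  assumes "1 < q" "0 < a"
  shows "qint q a (a * q ^ n) (first_variation q r P \<eta>) =
    a * (q - 1) * (\<Sum>k<n. q ^ k * (momentum q r P (Suc r) (a * q ^ k) * \<eta> (q ^ r * (a * q ^ k))))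
    + (boundary q r P \<eta> r (a * q ^ n) - boundary q r P \<eta> r a)"
proof (induction n)
  case (Suc n)
  have "a * q ^ n \<noteq> 0" "q - 1 \<noteq> 0" using assms by auto
  then have "a * (q - 1) * (q ^ n * qdiff q (boundary q r P \<eta> r) (a * q ^ n)) =
      boundary q r P \<eta> r (a * q ^ Suc n) - boundary q r P \<eta> r (a * q ^ n)"
    by (simp add: qdiff_def field_simps)
  with Suc show ?case
    using assms
    by (simp add: qint_qpoint first_variation_eq algebra_simps del: momentum.simps power_Suc)
qed (use qint_qpoint[OF assms, of 0] in simp)

lemma inf_from_tendsto_0:
  assumes "1 < q" "a \<in> qset q" and zero: "\<And>n. N \<le> n \<Longrightarrow> f (a * q ^ n) = 0"
  shows "(inf_from q f \<longlongrightarrow> 0) (qtop q a)"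
proof (rule tendsto_eventually)
  have a: "0 < a" using assms qset_pos by blast
  have "inf_from q f T = 0" if T: "T \<in> qset q" "a * q ^ N \<le> T" for T
  proof -
    have "f T' = 0" if T': "T' \<in> qset q" "T \<le> T'" for T'
    proof -
      have N: "a * q ^ N \<le> T'" using T T' by linarith
      have "a * 1 \<le> a * q ^ N" using a assms(1) by (intro mult_left_mono) auto
      with N obtain n where n: "T' = a * q ^ n"
        using qset_ge_obtain[OF assms(1,2) T'(1)] by fastforce
      with N a assms(1) have "N \<le> n" by (simp add: power_increasing_iff)
      then show ?thesis using zero n by simp
    qed
    then have "inf_from q f T = (INF T'\<in>{T' \<in> qset q. T \<le> T'}. 0)"
      unfolding inf_from_def by (intro INF_cong) auto
    also have "\<dots> = 0" using T by (intro INF_const) auto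
    finally show ?thesis .
  qed
  then show "\<forall>\<^sub>F T in qtop q a. inf_from q f T = 0"
    unfolding qtop_def eventually_inf_principal
    by (intro eventually_mono[OF eventually_ge_at_top[of "a * q ^ N"]]) auto
qed

lemma inf_from_le_limit:
  assumes "1 < q" "a \<in> qset q" "(inf_from q f \<longlongrightarrow> l) (qtop q a)"
  shows "inf_from q f T \<le> l"
proof (rule tendsto_lowerbound[OF assms(3)])
  have a: "0 < a" using assms qset_pos by blast
  have mono: "inf_from q f T \<le> inf_from q f T'" if "T \<le> T'" for T'
    unfolding inf_from_def by (rule INF_superset_mono) (use that in auto)
  then show "\<forall>\<^sub>F T' in qtop q a. inf_from q f T \<le> inf_from q f T'"
    unfolding qtop_def eventually_inf_principal
    by (intro eventually_mono[OF eventually_ge_at_top[of T]]) auto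
  show "qtop q a \<noteq> bot"
  proof
    assume "qtop q a = bot"
    then have "\<forall>\<^sub>F T in qtop q a. False" by simp
    then obtain M where M: "\<And>T. M \<le> T \<Longrightarrow> \<not> (T \<in> qset q \<and> a < T)"
      unfolding qtop_def eventually_inf_principal eventually_at_top_linorder by auto
    obtain n where "max M a < q ^ n" using real_arch_pow assms(1) by blast
    with M[of "q ^ n"] show False by (auto simp: qset_def)
  qed
qed

section \<open>The first variation of the functional\<close>

lemma jet_add_scaled:
  "jet q r ix (\<lambda>s. x s + e * \<eta> s) t = jet q r ix x t + e *\<^sub>R jet q r ix \<eta> t"
  by (simp add: jet_def vec_eq_iff Let_def comp_def qdiff_funpow_add_mult)

lemma C1_partial_derivative:
  assumes "(L t has_derivative f') (at u)"
  shows "pderivL ix (j + 2) L t u = f' (axis (ix (j + 1)) 1)"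
proof -
  define c where "c = ix (j + 1)"
  have "(\<chi> c'. if c' = c then s else u $ c') = u + (s - u $ c) *\<^sub>R axis c 1" for s
    by (auto simp: vec_eq_iff axis_def)
  then have eq: "(\<lambda>s. L t (\<chi> c'. if c' = c then s else u $ c')) =
      (\<lambda>s. L t (u + (s - u $ c) *\<^sub>R axis c 1))"
    by simp
  have "linear f'" using assms has_derivative_linear by blast
  have "((\<lambda>s. L t (u + (s - u $ c) *\<^sub>R axis c 1)) has_derivative (\<lambda>h. f' (h *\<^sub>R axis c 1)))
      (at (u $ c))"
    by (rule has_derivative_compose[where g = "L t"])
      (auto intro!: derivative_eq_intros simp: assms)
  then have "((\<lambda>s. L t (u + (s - u $ c) *\<^sub>R axis c 1)) has_real_derivative f' (axis c 1))
      (at (u $ c))"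
    by (rule has_derivative_imp_has_field_derivative) (simp add: linear_cmul[OF \<open>linear f'\<close>])
  then show ?thesis
    unfolding pderivL_def using eq DERIV_imp_deriv by (fastforce simp: c_def)
qed

text \<open>The jet depends linearly on the path, so the quotient is a directional derivative of
  \<open>L t\<close>; expanding the direction in the coordinate axes gives the partial derivatives.\<close>

lemma difference_quotient_tendsto:
  fixes ix :: "nat \<Rightarrow> 'n::finite"
  assumes bij: "bij_betw ix {1..r+1} UNIV" and "C1 (L t)"
  shows "((\<lambda>\<epsilon>. (lagr q r ix L (\<lambda>s. x s + \<epsilon> * \<eta> s) t - lagr q r ix L x t) / \<epsilon>) \<longlongrightarrow>
    first_variation q r (\<lambda>j s. pderivL ix (j + 2) L s (jet q r ix x s)) \<eta> t) (at 0)"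
proof -
  define u where "u = jet q r ix x t"
  define h where "h = jet q r ix \<eta> t"
  obtain f' where f': "(L t has_derivative f') (at u)" using assms(2) by (auto simp: C1_def)
  then have lin: "linear f'" using has_derivative_linear by blast
  have "((\<lambda>\<epsilon>. L t (u + \<epsilon> *\<^sub>R h)) has_derivative (\<lambda>e. f' (e *\<^sub>R h))) (at 0)"
    by (rule has_derivative_compose[where g = "L t"]) (auto intro!: derivative_eq_intros simp: f')
  then have "((\<lambda>\<epsilon>. L t (u + \<epsilon> *\<^sub>R h)) has_real_derivative f' h) (at 0)"
    by (rule has_derivative_imp_has_field_derivative) (simp add: linear_cmul[OF lin])
  then have "((\<lambda>\<epsilon>. (L t (u + \<epsilon> *\<^sub>R h) - L t u) / \<epsilon>) \<longlongrightarrow> f' h) (at 0)"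
    by (simp add: DERIV_def)
  moreover have "f' h = first_variation q r (\<lambda>j s. pderivL ix (j + 2) L s (jet q r ix x s)) \<eta> t"
  proof -
    have "f' h = f' (\<Sum>c\<in>UNIV. h $ c *\<^sub>R axis c 1)"
      using basis_expansion[of h] by (simp add: scalar_mult_eq_scaleR)
    also have "\<dots> = (\<Sum>c\<in>UNIV. h $ c * f' (axis c 1))"
      by (simp add: linear_sum[OF lin] linear_cmul[OF lin])
    also have "\<dots> = (\<Sum>j\<in>{1..r+1}. h $ ix j * f' (axis (ix j) 1))"
      using sum.reindex_bij_betw[OF bij, of "\<lambda>c. h $ c * f' (axis c 1)"] by simp
    also have "\<dots> = (\<Sum>j\<le>r. h $ ix (j + 1) * f' (axis (ix (j + 1)) 1))"
      by (rule sum.reindex_bij_witness[of _ "\<lambda>j. j + 1" "\<lambda>j. j - 1"]) auto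
    also have "\<dots> = first_variation q r (\<lambda>j s. pderivL ix (j + 2) L s (jet q r ix x s)) \<eta> t"
      unfolding first_variation_def
    proof (rule sum.cong)
      fix j assume "j \<in> {..r}"
      then have "h $ ix (j + 1) = (qdiff q ^^ j) (\<eta> \<circ> (sigma q ^^ (r - j))) t"
        unfolding h_def using jet_nth[OF bij, of "j + 1" q \<eta> t] by simp
      moreover have "pderivL ix (j + 2) L t u = f' (axis (ix (j + 1)) 1)"
        using f' by (rule C1_partial_derivative)
      ultimately show "h $ ix (j + 1) * f' (axis (ix (j + 1)) 1) =
          pderivL ix (j + 2) L t (jet q r ix x t) *
          (qdiff q ^^ j) (\<eta> \<circ> (sigma q ^^ (r - j))) t"
        by (simp add: u_def)
    qed simp
    finally show ?thesis .
  qed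
  ultimately show ?thesis by (simp add: lagr_def jet_add_scaled u_def h_def)
qed

text \<open>Weak maximality makes \<open>V(\<epsilon>, T)\<close> nonpositive for every \<open>T\<close>, because it increases to a
  nonpositive limit. So \<open>V(\<epsilon>, T) / \<epsilon>\<close> changes sign at \<open>\<epsilon> = 0\<close>, and its limit can only be zero.
  As \<open>V(\<epsilon>, T)\<close> is a lower bound for the integrals up to \<open>T' \<ge> T\<close>, the quotient of such an
  integral by \<open>\<epsilon>\<close> is at least \<open>V(\<epsilon>, T) / \<epsilon>\<close> on the right of zero and at most that on the left,
  which pins its limit, the first variation, to zero.\<close>

lemma integrated_first_variation_zero:
  fixes ix :: "nat \<Rightarrow> 'n::finite"
  assumes q: "1 < q" and aq: "a \<in> qset q"
    and bij: "bij_betw ix {1..r+1} UNIV"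
    and C1: "\<forall>t\<in>qset q. C1 (L t)"
    and wm: "weakly_maximal q a r ix \<alpha> L xs"
    and adm: "admissible q a r (\<lambda>_. 0) \<eta>"
    and lim: "\<And>T. T \<in> qset q \<Longrightarrow> a < T \<Longrightarrow>
      \<exists>l. ((\<lambda>\<epsilon>. V q a r ix L xs \<eta> \<epsilon> T / ereal \<epsilon>) \<longlongrightarrow> l) (at 0)"
  shows "qint q a (a * q ^ n)
    (first_variation q r (\<lambda>j s. pderivL ix (j + 2) L s (jet q r ix xs s)) \<eta>) = 0"
proof (cases "n = 0")
  case True
  then show ?thesis using q qset_pos[OF q aq] qint_qpoint[of q a 0] by simp
next
  case False
  have a: "0 < a" using qset_pos[OF q aq] .
  define T where "T = a * q ^ n"
  have T: "T \<in> qset q" "a < T"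
    using False q a qpoint_in_qset[OF aq] by (auto simp: T_def)
  define d where "d \<epsilon> = qint q a T
    (\<lambda>t. lagr q r ix L (\<lambda>s. xs s + \<epsilon> * \<eta> s) t - lagr q r ix L xs t)" for \<epsilon>
  define F where "F = qint q a T
    (first_variation q r (\<lambda>j s. pderivL ix (j + 2) L s (jet q r ix xs s)) \<eta>)"
  define v where "v \<epsilon> = V q a r ix L xs \<eta> \<epsilon> T" for \<epsilon>
  have v_le_0: "v \<epsilon> \<le> 0" for \<epsilon>
  proof -
    have "admissible q a r \<alpha> (\<lambda>s. xs s + \<epsilon> * \<eta> s)"
      using wm adm by (auto simp: weakly_maximal_def admissible_def qdiff_funpow_add_mult)
    then obtain l where "l \<le> 0" "(inf_from q (\<lambda>T'. qint q a T'
        (\<lambda>t. lagr q r ix L (\<lambda>s. xs s + \<epsilon> * \<eta> s) t - lagr q r ix L xs t)) \<longlongrightarrow> l) (qtop q a)"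
      using wm unfolding weakly_maximal_def by blast
    then show ?thesis
      using inf_from_le_limit[OF q aq] unfolding v_def V_def by (meson order_trans)
  qed
  have v_le_d: "v \<epsilon> \<le> ereal (d \<epsilon>)" for \<epsilon>
    unfolding v_def V_def inf_from_def d_def using T by (intro INF_lower) auto
  have d_lim: "((\<lambda>\<epsilon>. d \<epsilon> / \<epsilon>) \<longlongrightarrow> F) (at 0)"
    unfolding d_def F_def T_def qint_divide[symmetric]
    unfolding qint_qpoint[OF q a]
    using C1 qpoint_in_qset[OF aq]
    by (intro tendsto_intros difference_quotient_tendsto bij) auto
  obtain l where l: "((\<lambda>\<epsilon>. v \<epsilon> / ereal \<epsilon>) \<longlongrightarrow> l) (at 0)"
    using lim[OF T] unfolding v_def by blast
  have l_right: "((\<lambda>\<epsilon>. v \<epsilon> / ereal \<epsilon>) \<longlongrightarrow> l) (at_right 0)"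
    and l_left: "((\<lambda>\<epsilon>. v \<epsilon> / ereal \<epsilon>) \<longlongrightarrow> l) (at_left 0)"
    using l by (auto simp: filterlim_at_split)
  have d_right: "((\<lambda>\<epsilon>. ereal (d \<epsilon> / \<epsilon>)) \<longlongrightarrow> ereal F) (at_right 0)"
    and d_left: "((\<lambda>\<epsilon>. ereal (d \<epsilon> / \<epsilon>)) \<longlongrightarrow> ereal F) (at_left 0)"
    using d_lim by (auto simp: filterlim_at_split)
  have "v \<epsilon> / ereal \<epsilon> \<le> 0 \<and> v \<epsilon> / ereal \<epsilon> \<le> ereal (d \<epsilon> / \<epsilon>)" if "0 < \<epsilon>" for \<epsilon>
    using that v_le_0[of \<epsilon>] v_le_d[of \<epsilon>]
    by (cases "v \<epsilon>") (auto simp: divide_right_mono divide_nonpos_pos)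
  then have ev_right: "\<forall>\<^sub>F \<epsilon> in at_right 0. v \<epsilon> / ereal \<epsilon> \<le> 0 \<and> v \<epsilon> / ereal \<epsilon> \<le> ereal (d \<epsilon> / \<epsilon>)"
    by (auto simp: eventually_at_filter)
  have "0 \<le> v \<epsilon> / ereal \<epsilon> \<and> ereal (d \<epsilon> / \<epsilon>) \<le> v \<epsilon> / ereal \<epsilon>" if "\<epsilon> < 0" for \<epsilon>
    using that v_le_0[of \<epsilon>] v_le_d[of \<epsilon>]
    by (cases "v \<epsilon>") (auto simp: divide_right_mono_neg divide_nonpos_neg)
  then have ev_left: "\<forall>\<^sub>F \<epsilon> in at_left 0. 0 \<le> v \<epsilon> / ereal \<epsilon> \<and> ereal (d \<epsilon> / \<epsilon>) \<le> v \<epsilon> / ereal \<epsilon>"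
    by (auto simp: eventually_at_filter)
  have "l \<le> 0"
    by (rule tendsto_upperbound[OF l_right]) (use ev_right in \<open>auto elim: eventually_mono\<close>)
  moreover have "0 \<le> l"
    by (rule tendsto_lowerbound[OF l_left]) (use ev_left in \<open>auto elim: eventually_mono\<close>)
  moreover have "l \<le> ereal F"
    by (rule tendsto_le[OF _ d_right l_right]) (use ev_right in \<open>auto elim: eventually_mono\<close>)
  moreover have "ereal F \<le> l"
    by (rule tendsto_le[OF _ l_left d_left]) (use ev_left in \<open>auto elim: eventually_mono\<close>)
  ultimately have "F = 0" by (metis antisym ereal_eq_0(2))
  then show ?thesis by (simp add: F_def T_def)
qed

section \<open>Localisation by spikes\<close>

definition spike :: "real \<Rightarrow> real \<Rightarrow> real" where
  "spike p s = (if s = p then 1 else 0)"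

lemma spike_qpoint:
  assumes "1 < q" "0 < a"
  shows "spike (a * q ^ m) (q ^ j * (a * q ^ n)) = (if j + n = m then 1 else 0)"
proof -
  have "q ^ j * (a * q ^ n) = a * q ^ (j + n)" by (simp add: power_add)
  then have "spike (a * q ^ m) (q ^ j * (a * q ^ n)) = (if a * q ^ (j + n) = a * q ^ m then 1 else 0)"
    by (simp only: spike_def)
  then show ?thesis using assms by simp
qed

lemma spike_admissible:
  assumes "1 < q" "0 < a" "r \<le> m"
  shows "admissible q a r (\<lambda>_. 0) (spike (a * q ^ m))"
  unfolding admissible_def
proof (intro allI impI qdiff_funpow_eq_0)
  fix i j assume "i < r" "j \<le> i"
  then show "spike (a * q ^ m) (q ^ j * a) = 0"
    using spike_qpoint[OF assms(1,2), of m j 0] assms(3) by simp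
qed

lemma boundary_spike_initial:
  assumes "1 < q" "0 < a" "r \<le> m"
  shows "boundary q r P (spike (a * q ^ m)) r a = 0"
  using assms spike_qpoint[OF assms(1,2), of m _ 0] by (intro boundary_eq_0) auto

text \<open>A spike \<open>r\<close> steps to the right of \<open>t = a q\<^sup>m\<close> isolates the Euler--Lagrange expression at
  \<open>t\<close>, provided the integral extends so far that the spike has left the boundary term.\<close>

lemma euler_lagrange_of_first_variation:
  assumes q: "1 < q" and a: "0 < a"
    and zero: "\<And>\<eta> n. admissible q a r (\<lambda>_. 0) \<eta> \<Longrightarrow>
      qint q a (a * q ^ n) (first_variation q r P \<eta>) = 0"
  shows "momentum q r P (Suc r) (a * q ^ m) = 0"
proof -
  define \<eta> where "\<eta> = spike (a * q ^ (m + r))"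
  define n where "n = Suc (m + r)"
  have "boundary q r P \<eta> r (a * q ^ n) = 0"
    by (rule boundary_eq_0) (simp add: \<eta>_def n_def spike_qpoint[OF q a] del: power_Suc)
  moreover have "boundary q r P \<eta> r a = 0"
    unfolding \<eta>_def by (rule boundary_spike_initial) (use q a in auto)
  moreover have "qint q a (a * q ^ n) (first_variation q r P \<eta>) = 0"
    by (rule zero) (use q a in \<open>auto simp: \<eta>_def intro: spike_admissible\<close>)
  ultimately have "a * (q - 1) *
      (\<Sum>k<n. q ^ k * (momentum q r P (Suc r) (a * q ^ k) * \<eta> (q ^ r * (a * q ^ k)))) = 0"
    using qint_first_variation[OF q a, of n r P \<eta>] by simp
  then have "(\<Sum>k<n. q ^ k * (momentum q r P (Suc r) (a * q ^ k) * \<eta> (q ^ r * (a * q ^ k)))) = 0"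
    using q a by simp
  also have "(\<Sum>k<n. q ^ k * (momentum q r P (Suc r) (a * q ^ k) * \<eta> (q ^ r * (a * q ^ k)))) =
      (\<Sum>k<n. if k = m then q ^ m * momentum q r P (Suc r) (a * q ^ m) else 0)"
    by (rule sum.cong) (auto simp: \<eta>_def spike_qpoint[OF q a] add.commute simp del: momentum.simps)
  also have "\<dots> = q ^ m * momentum q r P (Suc r) (a * q ^ m)"
    by (simp add: n_def del: momentum.simps)
  finally show ?thesis using q by (simp del: momentum.simps)
qed

text \<open>Once the Euler--Lagrange equation holds, only the boundary term at the upper end remains.
  It is triangular: the difference of \<open>\<eta>\<close> that multiplies \<open>momentum k\<close> at \<open>t\<close> looks at
  \<open>q\<^sup>j t\<close> for \<open>k - 1 \<le> j \<le> r - 1\<close> only. A spike at \<open>q\<^sup>k\<^sup>-\<^sup>1 t\<close> therefore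
  reaches no momentum beyond the \<open>k\<close>-th, and the momenta vanish one after the other. The point
  \<open>t\<close> is taken at least \<open>r\<close> steps to the right of \<open>a\<close> so that the spike respects the initial
  conditions.\<close>

lemma momentum_vanishes_of_first_variation:
  assumes q: "1 < q" and a: "0 < a"
    and zero: "\<And>\<eta> n. admissible q a r (\<lambda>_. 0) \<eta> \<Longrightarrow>
      qint q a (a * q ^ n) (first_variation q r P \<eta>) = 0"
    and n: "r \<le> n"
  shows "k < r \<Longrightarrow> momentum q r P (Suc k) (a * q ^ n) = 0"
proof (induction k rule: less_induct)
  case (less k)
  define t where "t = a * q ^ n"
  define \<eta> where "\<eta> = spike (a * q ^ (k + n))"
  define G where "G l = (qdiff q ^^ (r - Suc l)) (\<eta> \<circ> (sigma q ^^ l)) t" for l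
  have \<eta>: "(\<eta> \<circ> (sigma q ^^ l)) (q ^ j * t) = (if l + j = k then 1 else 0)" for l j
    using spike_qpoint[OF q a, of "k + n" "l + j" n]
    by (simp add: \<eta>_def t_def sigma_funpow power_add mult.assoc)
  have "boundary q r P \<eta> r a = 0"
    unfolding \<eta>_def by (rule boundary_spike_initial) (use q a n in auto)
  moreover have "qint q a t (first_variation q r P \<eta>) = 0"
    unfolding t_def by (rule zero) (use q a n in \<open>auto simp: \<eta>_def intro: spike_admissible\<close>)
  moreover have "momentum q r P (Suc r) (a * q ^ j) = 0" for j
    by (rule euler_lagrange_of_first_variation[OF q a zero])
  ultimately have "boundary q r P \<eta> r t = 0"
    using qint_first_variation[OF q a, of n r P \<eta>] by (simp add: t_def del: momentum.simps)
  then have "(\<Sum>l<r. momentum q r P (Suc l) t * G l) = 0"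
    by (simp add: boundary_def G_def del: momentum.simps)
  also have "(\<Sum>l<r. momentum q r P (Suc l) t * G l) =
      (\<Sum>l<r. if l = k then momentum q r P (Suc k) t * G k else 0)"
  proof (rule sum.cong)
    fix l assume "l \<in> {..<r}"
    have "momentum q r P (Suc l) t * G l = 0" if "l < k"
      using less.IH[OF that] less.prems that by (simp add: t_def del: momentum.simps)
    moreover have "G l = 0" if "k < l"
      unfolding G_def by (rule qdiff_funpow_eq_0) (use that \<eta> in auto)
    ultimately show "momentum q r P (Suc l) t * G l =
        (if l = k then momentum q r P (Suc k) t * G k else 0)"
      by (cases l k rule: linorder_cases) (simp_all del: momentum.simps)
  qed simp
  also have "\<dots> = momentum q r P (Suc k) t * G k"
    using less.prems by (simp del: momentum.simps)
  finally have "momentum q r P (Suc k) t * G k = 0" .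
  moreover have "G k = (- 1 / ((q - 1) * t)) ^ (r - Suc k) * (\<eta> \<circ> (sigma q ^^ k)) t"
    unfolding G_def by (rule qdiff_funpow_leading) (use \<eta> in auto)
  then have "G k \<noteq> 0"
    using \<eta>[of k 0] q a by (simp add: t_def)
  ultimately show ?case by (simp add: t_def del: momentum.simps)
qed

section \<open>Euler--Lagrange equation and transversality conditions\<close>

theorem theorem4:
  fixes q a :: real and r :: nat and \<alpha> :: "nat \<Rightarrow> real"
    and ix :: "nat \<Rightarrow> 'n::finite"
    and L :: "real \<Rightarrow> real ^ 'n \<Rightarrow> real"
    and xs :: "real \<Rightarrow> real"
  assumes "1 < q" and "a \<in> qset q" and "1 \<le> r"
    and "bij_betw ix {1..r+1} UNIV"
    and "\<forall>t\<in>qset q. C1 (L t)"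
    and "weakly_maximal q a r ix \<alpha> L xs"
    and "\<And>\<eta> T. admissible q a r (\<lambda>_. 0) \<eta> \<Longrightarrow> T \<in> qset q \<Longrightarrow> a < T \<Longrightarrow>
           \<exists>l. ((\<lambda>\<epsilon>. V q a r ix L xs \<eta> \<epsilon> T / ereal \<epsilon>) \<longlongrightarrow> l) (at 0)"
    and "\<And>\<eta>. admissible q a r (\<lambda>_. 0) \<eta> \<Longrightarrow>
           \<exists>W. ereal_uniform_limit (UNIV - {0})
                 (\<lambda>T \<epsilon>. V q a r ix L xs \<eta> \<epsilon> T / ereal \<epsilon>) W (qtop q a)"
    and "\<And>\<eta> T. admissible q a r (\<lambda>_. 0) \<eta> \<Longrightarrow> T \<in> qset q \<Longrightarrow> a < T \<Longrightarrow>
           \<exists>S :: nat \<Rightarrow> real. (\<forall>n. S n \<in> qset q \<and> T \<le> S n) \<and>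
             ereal_uniform_limit (UNIV - {0})
               (\<lambda>n \<epsilon>. ereal (A q a r ix L xs \<eta> \<epsilon> (S n)))
               (\<lambda>\<epsilon>. inf_from q (A q a r ix L xs \<eta> \<epsilon>) T) sequentially"
  shows "(\<forall>t\<in>{t \<in> qset q. a \<le> t}.
            (\<Sum>i=0..r. (-1) ^ i * (1 / q) ^ (i * (i - 1) div 2) *
               (qdiff q ^^ i) (\<lambda>s. pderivL ix (i + 2) L s (jet q r ix xs s)) t) = 0)
    \<and> (\<forall>k\<in>{1..r}.
         (inf_from q (\<lambda>T'.
            (pderivL ix (r + 2 - (k - 1)) L T' (jet q r ix xs T')
             + (\<Sum>i=1..k - 1. (-1) ^ i *
                 (qdiff q ^^ i) (\<lambda>s. pderivL ix (r + 2 - (k - 1) + i) L s (jet q r ix xs s)) T'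
                 * Psi q r k i))
            * (qdiff q ^^ (r - k)) (xs \<circ> (sigma q ^^ (k - 1))) T')
          \<longlongrightarrow> 0) (qtop q a))"
proof -
  have q: "1 < q" and aq: "a \<in> qset q" by fact+
  have a: "0 < a" using qset_pos[OF q aq] .
  define P where "P j s = pderivL ix (j + 2) L s (jet q r ix xs s)" for j s
  have zero: "qint q a (a * q ^ n) (first_variation q r P \<eta>) = 0"
    if "admissible q a r (\<lambda>_. 0) \<eta>" for \<eta> n
    unfolding P_def using assms(1,2,4-6) that assms(7)[OF that]
    by (rule integrated_first_variation_zero)
  show ?thesis
  proof (intro conjI ballI)
    fix t assume "t \<in> {t \<in> qset q. a \<le> t}"
    then obtain m where m: "t = a * q ^ m" using qset_ge_obtain[OF q aq] by auto
    have "momentum q r P (Suc r) t = 0"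
      unfolding m by (rule euler_lagrange_of_first_variation[OF q a zero])
    also have "momentum q r P (Suc r) t =
        (\<Sum>i=0..r. (-1) ^ i * (1 / q) ^ (i * (i - 1) div 2) * (qdiff q ^^ i) (P i) t)"
      by (simp add: momentum_closed_form Psi_last lessThan_Suc_atMost atLeast0AtMost
          del: momentum.simps sum.lessThan_Suc)
    finally show "(\<Sum>i=0..r. (-1) ^ i * (1 / q) ^ (i * (i - 1) div 2) *
        (qdiff q ^^ i) (\<lambda>s. pderivL ix (i + 2) L s (jet q r ix xs s)) t) = 0"
      by (simp only: P_def[abs_def])
  next
    fix k assume k: "k \<in> {1..r}"
    then obtain k' where k': "k = Suc k'" "k' < r" by (cases k) auto
    have idx: "r + 2 - (k - 1) + i = (Suc r - k + i) + 2" for i using k by auto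
    have "pderivL ix (r + 2 - (k - 1)) L T' (jet q r ix xs T') + (\<Sum>i=1..k - 1. (-1) ^ i *
          (qdiff q ^^ i) (\<lambda>s. pderivL ix (r + 2 - (k - 1) + i) L s (jet q r ix xs s)) T'
          * Psi q r k i) = momentum q r P k T'" for T'
    proof -
      have "momentum q r P k T' =
          (\<Sum>i<k. ((-1) ^ i * Psi q r k i) * (qdiff q ^^ i) (P (Suc r - k + i)) T')"
        using k by (intro momentum_closed_form) auto
      also have "{..<k} = insert 0 {1..k - 1}" using k by auto
      finally show ?thesis
        using idx[of 0] by (simp add: idx P_def[abs_def] Psi_def mult_ac)
    qed
    moreover have "momentum q r P k (a * q ^ n) = 0" if "r \<le> n" for n
      unfolding k'(1) by (rule momentum_vanishes_of_first_variation[OF q a zero that k'(2)])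
    ultimately show "(inf_from q (\<lambda>T'.
            (pderivL ix (r + 2 - (k - 1)) L T' (jet q r ix xs T')
             + (\<Sum>i=1..k - 1. (-1) ^ i *
                 (qdiff q ^^ i) (\<lambda>s. pderivL ix (r + 2 - (k - 1) + i) L s (jet q r ix xs s)) T'
                 * Psi q r k i))
            * (qdiff q ^^ (r - k)) (xs \<circ> (sigma q ^^ (k - 1))) T')
          \<longlongrightarrow> 0) (qtop q a)"
      by (intro inf_from_tendsto_0[OF q aq, of r]) simp
  qed
qed

end
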